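(* Let $w$ be a Dyck word in the alphabet $\{x,D\}$. For all integers $k \geq 0$, $$S_w(k) = {G_w \brace k}.$$
   Context: Stirling numbers of a word. View $x$ as the operator of multiplication by the variable $x$ and $D$ as differentiation with respect to $x$, acting on infinitely differentiable functions (say on $(0,\infty)$); a word in $\{x,D\}$ is read as the composition of these operators (so $Dx = xD+1$). For every word $w$ with $m$ $x$'s and $n$ $D$'s there is a unique sequence of integers $(S_w(k))_{k\ge 0}$ (only finitely many nonzero) with $$w = x^{m-n}\sum_{k\ge 0} S_w(k)\, x^k D^k .$$ Dyck words. A word $w$ in $\{x,D\}$ is a Dyck word if it has the same number of $x$'s as $D$'s and every initial segment (reading left to right) has at least as many $x$'s as $D$'s. A (non-empty) Dyck word is irreducible if it is $xD$ or is of the form $xw'D$ with $w'$ a non-empty Dyck word; otherwise it is reducible, and it can then be written in a unique way as $w=w_1\cdots w_\ell$ with each $w_i$ irreducible. Words here are non-empty. The graph $G_w$. To each (non-empty) Dyck word $w$ associate an unlabeled graph $G_w$ inductively: (1) if $w=xD$, then $G_w=K_1$ (a single vertex); (2) if $w=xw'D$ is irreducible with $w'$ a non-empty Dyck word, then $G_w$ is obtained from $G_{w'}$ by adding a dominating vertex (a new vertex adjacent to all vertices of $G_{w'}$); (3) if $w=w_1\cdots w_\ell$ is reducible with each $w_i$ irreducible, then $G_w$ is the disjoint union of $G_{w_1},\dots,G_{w_\ell}$. Graph Stirling numbers. For a graph $G$ and an integer $k\ge0$, ${G\brace k}$ is the number of partitions of the vertex set of $G$ into $k$ non-empty classes, none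 of which contains both endvertices of an edge of $G$. *)

theory Defs
  imports "HOL-Analysis.Analysis" "HOL-Library.Disjoint_Sets" "HOL-Library.Sublist"
begin

datatype letter = X | D

primrec letter_op :: "letter \<Rightarrow> (real \<Rightarrow> real) \<Rightarrow> (real \<Rightarrow> real)" where
  "letter_op X f = (\<lambda>t. t * f t)"
| "letter_op D f = deriv f"

text \<open>A word acts as the composition of its letters, so the rightmost letter acts first.\<close>

primrec word_op :: "letter list \<Rightarrow> (real \<Rightarrow> real) \<Rightarrow> (real \<Rightarrow> real)" where
  "word_op [] f = f"
| "word_op (a # w) f = letter_op a (word_op w f)"

text \<open>
  Smooth functions on \<open>(0,\<infinity>)\<close> are represented by total functions that are arbitrary
  outside \<open>(0,\<infinity>)\<close>. As \<open>(0,\<infinity>)\<close> is open, the values there of \<open>deriv f\<close> do not depend on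
  how \<open>f\<close> is extended.
\<close>

definition smooth_pos :: "(real \<Rightarrow> real) \<Rightarrow> bool" where
  "smooth_pos f \<longleftrightarrow> (\<forall>n. (deriv ^^ n) f differentiable_on {0<..})"

text \<open>
  The expansion \<open>w = x\<^sup>m\<^sup>-\<^sup>n \<Sum>\<^sub>k S k x\<^sup>k D\<^sup>k\<close> as an identity of operators on the smooth functions
  on \<open>(0,\<infinity>)\<close>; the exponent of the leading power of \<open>x\<close> may be negative.
\<close>

definition is_normal_expansion :: "letter list \<Rightarrow> (nat \<Rightarrow> int) \<Rightarrow> bool" where
  "is_normal_expansion w S \<longleftrightarrow>
     finite {k. S k \<noteq> 0} \<and>
     (\<forall>f. smooth_pos f \<longrightarrow>
        (\<forall>t>0. word_op w f t =
           t powi (int (count_list w X) - int (count_list w D)) *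
           (\<Sum>k | S k \<noteq> 0. of_int (S k) * t ^ k * (deriv ^^ k) f t)))"

definition word_stirling :: "letter list \<Rightarrow> nat \<Rightarrow> int" where
  "word_stirling w = (THE S. is_normal_expansion w S)"

definition dyck_word :: "letter list \<Rightarrow> bool" where
  "dyck_word w \<longleftrightarrow>
     w \<noteq> [] \<and> count_list w X = count_list w D \<and>
     (\<forall>u. prefix u w \<longrightarrow> count_list u D \<le> count_list u X)"

definition irreducible_dyck :: "letter list \<Rightarrow> bool" where
  "irreducible_dyck w \<longleftrightarrow>
     w = [X, D] \<or> (\<exists>w'. dyck_word w' \<and> w = X # w' @ [D])"

text \<open>A simple graph is given by its vertex set and its set of edges, each edge being a
  two-element set of vertices.\<close>

type_synonym 'v graph = "'v set \<times> 'v set set"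

definition add_dominating :: "'v \<Rightarrow> 'v graph \<Rightarrow> 'v graph" where
  "add_dominating v G = (insert v (fst G), snd G \<union> {{v, u} | u. u \<in> fst G})"

definition graph_union :: "'v graph list \<Rightarrow> 'v graph" where
  "graph_union Gs = (\<Union>(fst ` set Gs), \<Union>(snd ` set Gs))"

definition pairwise_disjoint :: "'v graph list \<Rightarrow> bool" where
  "pairwise_disjoint Gs \<longleftrightarrow> sorted_wrt (\<lambda>G H. fst G \<inter> fst H = {}) Gs"

text \<open>
  The unlabeled graph \<open>G\<^sub>w\<close> is an isomorphism class; \<open>dyck_graph w G\<close> says that the labeled graph
  \<open>G\<close> is one of its representatives. The names of the vertices are arbitrary: a new vertex may be
  any element not yet used, and the components of a disjoint union may be any representatives with
  pairwise disjoint vertex sets.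
\<close>

inductive dyck_graph :: "letter list \<Rightarrow> 'v graph \<Rightarrow> bool" where
  single: "dyck_graph [X, D] ({v}, {})"
| dominate: "dyck_word w' \<Longrightarrow> dyck_graph w' G \<Longrightarrow> v \<notin> fst G \<Longrightarrow>
    dyck_graph (X # w' @ [D]) (add_dominating v G)"
| disjoint_union: "2 \<le> length ws \<Longrightarrow> \<forall>u\<in>set ws. irreducible_dyck u \<Longrightarrow>
    list_all2 dyck_graph ws Gs \<Longrightarrow> pairwise_disjoint Gs \<Longrightarrow>
    dyck_graph (concat ws) (graph_union Gs)"

definition graph_stirling :: "'v graph \<Rightarrow> nat \<Rightarrow> nat" where
  "graph_stirling G k =
     card {P. partition_on (fst G) P \<and> card P = k \<and> (\<forall>C\<in>P. \<forall>e\<in>snd G. \<not> e \<subseteq> C)}"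

lemma dyck_word_split:
  assumes "dyck_word (u @ v)" "u \<noteq> []" "v \<noteq> []" "count_list u X = count_list u D"
  shows "dyck_word u" "dyck_word v"
proof -
  have pre: "count_list p D \<le> count_list p X" if "prefix p (u @ v)" for p
    using assms(1) that by (auto simp: dyck_word_def)
  show "dyck_word u"
    using assms pre by (auto simp: dyck_word_def)
  have "count_list p D \<le> count_list p X" if "prefix p v" for p
    using pre[of "u @ p"] that assms(4) by simp
  then show "dyck_word v"
    using assms by (auto simp: dyck_word_def)
qed

lemma dyck_word_unsplit:
  assumes "dyck_word w"
    and nosplit: "\<And>u v. w = u @ v \<Longrightarrow> u \<noteq> [] \<Longrightarrow> v \<noteq> [] \<Longrightarrow> count_list u X \<noteq> count_list u D"
  shows "irreducible_dyck w"
proof -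
  have pre: "count_list p D \<le> count_list p X" if "prefix p w" for p
    using assms(1) that by (auto simp: dyck_word_def)
  have bal: "count_list w X = count_list w D" and "w \<noteq> []"
    using assms(1) by (auto simp: dyck_word_def)
  obtain a r where w1: "w = a # r"
    using \<open>w \<noteq> []\<close> by (cases w) auto
  have "a = X"
    using pre[of "[a]"] w1 by (cases a) auto
  have "r \<noteq> []"
    using bal w1 by (cases a) auto
  then obtain m b where r: "r = m @ [b]"
    by (cases r rule: rev_cases) auto
  have w2: "w = X # m @ [b]"
    using w1 r \<open>a = X\<close> by simp
  have strict: "count_list p D \<le> count_list p X" if "prefix p m" for p
  proof -
    obtain q where q: "m = p @ q"
      using \<open>prefix p m\<close> by (auto simp: prefix_def)
    have w: "w = (X # p) @ (q @ [b])"
      using w2 q by simp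
    then have "prefix (X # p) w"
      by (auto simp: prefix_def)
    then show ?thesis
      using pre[of "X # p"] nosplit[OF w] by simp
  qed
  have "b = D"
    using bal strict[of m] w2 by (cases b) auto
  then have "m = [] \<or> dyck_word m"
    using strict bal w2 by (auto simp: dyck_word_def)
  then show ?thesis
    using w2 \<open>b = D\<close> by (auto simp: irreducible_dyck_def)
qed

lemma dyck_word_factors:
  "dyck_word w \<Longrightarrow> \<exists>ws. w = concat ws \<and> ws \<noteq> [] \<and> (\<forall>u\<in>set ws. irreducible_dyck u)"
proof (induction w rule: length_induct)
  case (1 w)
  show ?case
  proof (cases "\<exists>u v. w = u @ v \<and> u \<noteq> [] \<and> v \<noteq> [] \<and> count_list u X = count_list u D")
    case True
    then obtain u v where uv: "w = u @ v" "u \<noteq> []" "v \<noteq> []" "count_list u X = count_list u D"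
      by blast
    have "dyck_word u" "dyck_word v"
      using dyck_word_split[OF _ uv(2-4)] 1(2) uv(1) by auto
    moreover have "length u < length w" "length v < length w"
      using uv by auto
    ultimately obtain us vs where
      "u = concat us" "us \<noteq> []" "\<forall>u\<in>set us. irreducible_dyck u"
      "v = concat vs" "\<forall>u\<in>set vs. irreducible_dyck u"
      using 1(1) by metis
    then show ?thesis
      using uv(1) by (intro exI[of _ "us @ vs"]) auto
  next
    case False
    then have "irreducible_dyck w"
      using dyck_word_unsplit[OF 1(2)] by blast
    then show ?thesis
      by (intro exI[of _ "[w]"]) auto
  qed
qed

lemma irreducible_dyck_imp_dyck_word:
  assumes "irreducible_dyck w"
  shows "dyck_word w"
proof -
  have *: "dyck_word (X # m @ [D])" if m: "m = [] \<or> dyck_word m" for m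
  proof -
    have "count_list u D \<le> count_list u X" if "prefix u (X # m @ [D])" for u
    proof (cases u)
      case (Cons a p)
      then have "a = X" "prefix p (m @ [D])"
        using \<open>prefix u (X # m @ [D])\<close> by auto
      moreover from this(2) have "p = m @ [D] \<or> prefix p m"
        by simp
      moreover have "count_list q D \<le> count_list q X" if "prefix q m" for q
        using m that by (auto simp: dyck_word_def)
      moreover have "count_list m D = count_list m X"
        using m by (auto simp: dyck_word_def)
      ultimately show ?thesis
        using Cons le_SucI by fastforce
    qed simp
    moreover have "count_list m D = count_list m X"
      using m by (auto simp: dyck_word_def)
    ultimately show ?thesis
      by (simp add: dyck_word_def)
  qed
  show ?thesis
    using assms *[of "[]"] * unfolding irreducible_dyck_def by (metis append_Nil)
qed

text \<open>Together with \<open>infinite_UNIV_nat\<close>: every Dyck word has a representing graph on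
  natural numbers.\<close>

lemma dyck_graph_exists:
  assumes "dyck_word w" and "infinite A"
  shows "\<exists>G. dyck_graph w G \<and> finite (fst G) \<and> fst G \<subseteq> A"
  using assms
proof (induction w arbitrary: A rule: length_induct)
  case (1 w)
  have IH: "\<exists>G. dyck_graph u G \<and> finite (fst G) \<and> fst G \<subseteq> B"
    if "length u < length w" "dyck_word u" "infinite B" for u and B :: "'a set"
    using 1(1) that by blast
  obtain ws where ws: "w = concat ws" "ws \<noteq> []" "\<forall>u\<in>set ws. irreducible_dyck u"
    using dyck_word_factors[OF 1(2)] by blast
  show ?case
  proof (cases "length ws \<ge> 2")
    case False
    then obtain u where "ws = [u]"
      using ws(2) by (cases ws rule: list.exhaust; cases "tl ws") auto
    then have "irreducible_dyck w"
      using ws by auto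
    then consider "w = [X, D]" | m where "dyck_word m" "w = X # m @ [D]"
      by (auto simp: irreducible_dyck_def)
    then show ?thesis
    proof cases
      case 1
      obtain a where "a \<in> A"
        using \<open>infinite A\<close> by (metis finite.emptyI all_not_in_conv)
      then show ?thesis
        using 1 by (intro exI[of _ "({a}, {})"]) (auto intro: dyck_graph.single)
    next
      case 2
      then obtain G where G: "dyck_graph m G" "finite (fst G)" "fst G \<subseteq> A"
        using IH[of m A] \<open>infinite A\<close> by auto
      obtain a where "a \<in> A" "a \<notin> fst G"
        using G(2) \<open>infinite A\<close> by (meson finite_subset subsetI)
      then show ?thesis
        using 2 G dyck_graph.dominate[of m G a]
        by (intro exI[of _ "add_dominating a G"]) (auto simp: add_dominating_def)
    qed
  next
    case True
    have short: "length u < length w" if u: "u \<in> set ws" for u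
    proof -
      obtain p q where pq: "ws = p @ u # q"
        using split_list[OF u] by blast
      then have "p @ q \<noteq> []"
        using True by auto
      then obtain v where "v \<in> set (p @ q)"
        by (metis list.set_sel(1))
      then have "v \<noteq> []" "v \<in> set p \<or> v \<in> set q"
        using ws(3) pq irreducible_dyck_imp_dyck_word[of v] by (auto simp: dyck_word_def)
      then have "concat p \<noteq> [] \<or> concat q \<noteq> []"
        by auto
      then show ?thesis
        using pq ws(1) by auto
    qed
    have "\<exists>Gs. list_all2 dyck_graph vs Gs \<and> pairwise_disjoint Gs \<and>
             (\<forall>G\<in>set Gs. finite (fst G) \<and> fst G \<subseteq> A)"
      if "set vs \<subseteq> set ws" for vs
      using that
    proof (induction vs)
      case Nil
      then show ?case
        by (intro exI[of _ "[]"]) (auto simp: pairwise_disjoint_def)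
    next
      case (Cons v vs)
      then obtain Gs where Gs: "list_all2 dyck_graph vs Gs" "pairwise_disjoint Gs"
          "\<forall>G\<in>set Gs. finite (fst G) \<and> fst G \<subseteq> A"
        by auto
      have "finite (\<Union>(fst ` set Gs))"
        using Gs(3) by auto
      then have "infinite (A - \<Union>(fst ` set Gs))"
        using \<open>infinite A\<close> by (rule Diff_infinite_finite)
      moreover have "dyck_word v"
        using Cons.prems ws(3) irreducible_dyck_imp_dyck_word by auto
      moreover have "length v < length w"
        using short Cons.prems by simp
      ultimately obtain G where "dyck_graph v G" "finite (fst G)"
          "fst G \<subseteq> A - \<Union>(fst ` set Gs)"
        using IH by blast
      moreover from this(3) have "fst G \<subseteq> A" "\<forall>H\<in>set Gs. fst G \<inter> fst H = {}"
        by auto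
      ultimately show ?case
        using Gs by (intro exI[of _ "G # Gs"]) (simp add: pairwise_disjoint_def)
    qed
    from this[of ws] obtain Gs where Gs: "list_all2 dyck_graph ws Gs" "pairwise_disjoint Gs"
        "\<forall>G\<in>set Gs. finite (fst G) \<and> fst G \<subseteq> A"
      by auto
    have "dyck_graph w (graph_union Gs)"
      using dyck_graph.disjoint_union[OF True ws(3) Gs(1,2)] ws(1) by simp
    then show ?thesis
      using Gs(3) by (intro exI[of _ "graph_union Gs"]) (auto simp: graph_union_def)
  qed
qed

end

theory Submission
  imports Defs
begin

text \<open>
  Both sides are the coefficients of one and the same polynomial, written in the basis of falling
  factorials \<open>n (n - 1) \<cdots> (n - k + 1)\<close>: the chromatic polynomial of \<open>G\<close>.

  On the graph side, a proper colouring of \<open>G\<close> with \<open>n\<close> colours amounts to a partition of the vertices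
  into stable classes together with an injective assignment of colours to the classes. So the number
  of proper colourings is \<open>\<Sum>\<^sub>k s(k) n (n - 1) \<cdots> (n - k + 1)\<close>, with \<open>s(k)\<close> the graph Stirling numbers; this is
  \<open>card_proper_colorings\<close>.

  On the word side, let the word act on the power \<open>t\<^sup>n\<close>. A Dyck word sends \<open>t\<^sup>n\<close> to a multiple of itself,
  and by the recursive construction of the graph the factor is the number of proper colourings with
  \<open>n\<close> colours (\<open>dyck_graph_acts_by_colorings\<close>): concatenating words multiplies the factors, just as
  a disjoint union multiplies numbers of colourings; and in \<open>x w' D\<close> the letter \<open>D\<close> produces a factor
  \<open>n\<close> and leaves \<open>t\<^sup>n\<^sup>-\<^sup>1\<close> for \<open>w'\<close>, just as a dominating vertex takes one of \<open>n\<close> colours and leaves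
  \<open>n - 1\<close> for the other vertices. On the other hand, by the normal expansion of \<open>w\<close>, the value of
  \<open>w t\<^sup>n\<close> at \<open>t = 1\<close> is \<open>\<Sum>\<^sub>k S\<^sub>w(k) n (n - 1) \<cdots> (n - k + 1)\<close>, because
  \<open>D\<^sup>k t\<^sup>n = n (n - 1) \<cdots> (n - k + 1) t\<^sup>n\<^sup>-\<^sup>k\<close>.

  Coefficients with respect to falling factorials are determined by the values at the natural numbers
  (\<open>falling_fact_coeffs_unique\<close>), so the two sequences agree. The same argument gives uniqueness of
  the normal expansion of any word; existence is an induction on the letters, differentiating the
  expansion term by term.
\<close>

section \<open>Falling factorials\<close>

definition falling_fact :: "nat \<Rightarrow> nat \<Rightarrow> nat" where
  "falling_fact n k = prod ((-) n) {0..<k}"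

lemma falling_fact_eq_0: "n < k \<Longrightarrow> falling_fact n k = 0"
  by (auto simp: falling_fact_def)

lemma falling_fact_self: "falling_fact n n \<noteq> 0"
  by (auto simp: falling_fact_def)

lemma falling_fact_Suc: "falling_fact n (Suc k) = falling_fact n k * (n - k)"
  by (simp add: falling_fact_def)

text \<open>
  The system of equations is triangular: at \<open>n\<close> only the terms with \<open>k \<le> n\<close> survive, and the factor of
  the last one, \<open>n!\<close>, is nonzero. So the coefficients can be compared one after the other.
\<close>

lemma falling_fact_coeffs_unique:
  fixes a b :: "nat \<Rightarrow> int"
  assumes fin: "finite {k. a k \<noteq> 0}" "finite {k. b k \<noteq> 0}"
    and eq: "\<And>n. (\<Sum>k | a k \<noteq> 0. a k * int (falling_fact n k)) =
                (\<Sum>k | b k \<noteq> 0. b k * int (falling_fact n k))"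
  shows "a = b"
proof
  fix n
  define A where "A = {k. a k \<noteq> 0} \<union> {k. b k \<noteq> 0}"
  have "finite A"
    using fin by (simp add: A_def)
  have a: "(\<Sum>k | a k \<noteq> 0. a k * int (falling_fact n k)) = (\<Sum>k\<in>A. a k * int (falling_fact n k))" for n
    using \<open>finite A\<close> by (intro sum.mono_neutral_left) (auto simp: A_def)
  have b: "(\<Sum>k | b k \<noteq> 0. b k * int (falling_fact n k)) = (\<Sum>k\<in>A. b k * int (falling_fact n k))" for n
    using \<open>finite A\<close> by (intro sum.mono_neutral_left) (auto simp: A_def)
  have zero: "(\<Sum>k\<in>A. (a k - b k) * int (falling_fact n k)) = 0" for n
    using eq[of n] unfolding a b by (simp add: left_diff_distrib sum_subtractf)
  show "a n = b n"
  proof (induction n rule: less_induct)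
    case (less n)
    show ?case
    proof (cases "n \<in> A")
      case True
      have "(\<Sum>k\<in>A. (a k - b k) * int (falling_fact n k)) =
            (\<Sum>k\<in>{n}. (a k - b k) * int (falling_fact n k))"
      proof (rule sum.mono_neutral_right)
        show "\<forall>k\<in>A - {n}. (a k - b k) * int (falling_fact n k) = 0"
        proof
          fix k assume "k \<in> A - {n}"
          then have "k < n \<or> n < k" by auto
          then show "(a k - b k) * int (falling_fact n k) = 0"
            using less falling_fact_eq_0[of n k] by auto
        qed
      qed (use \<open>finite A\<close> True in auto)
      then show ?thesis
        using zero[of n] falling_fact_self[of n] by simp
    qed (auto simp: A_def)
  qed
qed

section \<open>Proper colourings\<close>

text \<open>
  Nonemptiness of edges matters for the link with partitions: an empty edge would forbid every
  colouring, but no partition of the empty vertex set.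
\<close>

definition wf_graph :: "'v graph \<Rightarrow> bool" where
  "wf_graph G \<longleftrightarrow> finite (fst G) \<and> (\<forall>e\<in>snd G. e \<noteq> {} \<and> e \<subseteq> fst G)"

definition proper_colorings :: "'v graph \<Rightarrow> 'c set \<Rightarrow> ('v \<Rightarrow> 'c) set" where
  "proper_colorings G C = {f \<in> fst G \<rightarrow>\<^sub>E C. \<forall>e\<in>snd G. \<forall>c. \<exists>v\<in>e. f v \<noteq> c}"

lemma proper_coloringsI:
  assumes "f \<in> fst G \<rightarrow>\<^sub>E C" "\<And>e c. e \<in> snd G \<Longrightarrow> \<exists>v\<in>e. f v \<noteq> c"
  shows "f \<in> proper_colorings G C"
  using assms by (simp add: proper_colorings_def)

definition stable_partitions :: "'v graph \<Rightarrow> 'v set set set" where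
  "stable_partitions G = {P. partition_on (fst G) P \<and> (\<forall>B\<in>P. \<forall>e\<in>snd G. \<not> e \<subseteq> B)}"

definition color_classes :: "'v set \<Rightarrow> ('v \<Rightarrow> 'c) \<Rightarrow> 'v set set" where
  "color_classes V f = (\<lambda>c. {v \<in> V. f v = c}) ` (f ` V)"

definition block_of :: "'v set set \<Rightarrow> 'v \<Rightarrow> 'v set" where
  "block_of P v = (THE B. B \<in> P \<and> v \<in> B)"

lemma block_of_eq:
  assumes "partition_on V P" "B \<in> P" "v \<in> B"
  shows "block_of P v = B"
  unfolding block_of_def
proof (rule the_equality)
  fix B' assume "B' \<in> P \<and> v \<in> B'"
  then show "B' = B"
    using assms disjointD[OF partition_onD2[OF assms(1)], of B' B] by auto
qed (use assms in auto)

lemma block_of_mem: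
  assumes "partition_on V P" "v \<in> V"
  shows "block_of P v \<in> P" "v \<in> block_of P v"
proof -
  obtain B where "B \<in> P" "v \<in> B"
    using assms partition_onD1 by blast
  then show "block_of P v \<in> P" "v \<in> block_of P v"
    using block_of_eq[OF assms(1)] by auto
qed

lemma partition_on_color_classes: "partition_on V (color_classes V f)"
  by (rule partition_onI) (auto simp: color_classes_def disjnt_def)

definition color_blocks :: "'v set \<Rightarrow> 'v set set \<times> ('v set \<Rightarrow> 'c) \<Rightarrow> 'v \<Rightarrow> 'c" where
  "color_blocks V = (\<lambda>(P, g). \<lambda>v\<in>V. g (block_of P v))"

lemma color_classes_color_blocks:
  assumes "partition_on V P" "inj_on g P"
  shows "color_classes V (color_blocks V (P, g)) = P"
proof -
  have *: "{u \<in> V. g (block_of P u) = g (block_of P v)} = block_of P v" if "v \<in> V" for v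
    using assms that block_of_mem[OF assms(1)] block_of_eq[OF assms(1)] partition_onD1[OF assms(1)]
    by (auto simp: inj_on_def)
  have "color_classes V (color_blocks V (P, g)) =
      (\<lambda>v. {u \<in> V. g (block_of P u) = g (block_of P v)}) ` V"
    by (auto simp: color_classes_def color_blocks_def image_image cong: conj_cong)
  also have "\<dots> = block_of P ` V"
    using * by (intro image_cong) auto
  also have "\<dots> = P"
  proof
    show "P \<subseteq> block_of P ` V"
    proof
      fix B assume "B \<in> P"
      moreover from this obtain v where "v \<in> B"
        using partition_onD3[OF assms(1)] by fastforce
      ultimately show "B \<in> block_of P ` V"
        using block_of_eq[OF assms(1)] partition_onD1[OF assms(1)] by blast
    qed
  qed (use block_of_mem[OF assms(1)] in auto)
  finally show ?thesis .
qed

text \<open>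
  A proper colouring is the same thing as a stable partition (its colour classes) with an injective
  colouring of the blocks. Properness of the colouring and stability of the classes both say that no
  edge is monochromatic.
\<close>

lemma bij_betw_color_blocks:
  assumes "wf_graph G"
  shows "bij_betw (color_blocks (fst G))
    (SIGMA P:stable_partitions G. {g \<in> P \<rightarrow>\<^sub>E C. inj_on g P}) (proper_colorings G C)"
  (is "bij_betw ?F ?S _")
  unfolding bij_betw_def
proof
  show "inj_on ?F ?S"
  proof (rule inj_onI, clarify)
    fix P g Q h
    assume P: "P \<in> stable_partitions G" and g: "g \<in> P \<rightarrow>\<^sub>E C" "inj_on g P"
      and Q: "Q \<in> stable_partitions G" and h: "h \<in> Q \<rightarrow>\<^sub>E C" "inj_on h Q"
      and eq: "?F (P, g) = ?F (Q, h)"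
    have part: "partition_on (fst G) P" "partition_on (fst G) Q"
      using P Q by (auto simp: stable_partitions_def)
    then have "P = Q"
      using color_classes_color_blocks[OF part(1) g(2)] color_classes_color_blocks[OF part(2) h(2)] eq
      by simp
    have "g B = h B" if B: "B \<in> P" for B
    proof -
      obtain v where "v \<in> B"
        using partition_onD3[OF part(1)] B by (metis ex_in_conv)
      moreover from this have "v \<in> fst G"
        using partition_onD1[OF part(1)] B by blast
      ultimately show ?thesis
        using fun_cong[OF eq, of v] \<open>P = Q\<close> block_of_eq[OF part(1) B]
        by (simp add: color_blocks_def)
    qed
    then have "g = h"
      using g(1) h(1) \<open>P = Q\<close> by (auto intro: PiE_ext)
    then show "P = Q \<and> g = h"
      using \<open>P = Q\<close> by simp
  qed
  show "?F ` ?S = proper_colorings G C"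
  proof
    show "?F ` ?S \<subseteq> proper_colorings G C"
    proof clarify
      fix P g
      assume P: "P \<in> stable_partitions G" and g: "g \<in> P \<rightarrow>\<^sub>E C" "inj_on g P"
      have part: "partition_on (fst G) P"
        using P by (auto simp: stable_partitions_def)
      have "\<exists>v\<in>e. ?F (P, g) v \<noteq> c" if e: "e \<in> snd G" for e c
      proof (rule ccontr)
        assume "\<not> (\<exists>v\<in>e. ?F (P, g) v \<noteq> c)"
        then have mono: "?F (P, g) v = c" if "v \<in> e" for v
          using that by blast
        obtain u where u: "u \<in> e" "e \<subseteq> fst G"
          using e assms by (auto simp: wf_graph_def)
        have "g (block_of P v) = c" if "v \<in> e" for v
          using mono[OF that] that u(2) by (auto simp: color_blocks_def)
        then have "g (block_of P v) = g (block_of P u)" if "v \<in> e" for v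
          using that u(1) by simp
        then have "block_of P v = block_of P u" if "v \<in> e" for v
          using that u g(2) block_of_mem[OF part] by (meson inj_onD subsetD)
        then have "e \<subseteq> block_of P u"
          using u block_of_mem[OF part] by blast
        then show False
          using P e u block_of_mem[OF part, of u] by (auto simp: stable_partitions_def)
      qed
      moreover have "?F (P, g) \<in> fst G \<rightarrow>\<^sub>E C"
        using g block_of_mem[OF part] by (auto simp: color_blocks_def)
      ultimately show "?F (P, g) \<in> proper_colorings G C"
        by (auto simp: proper_colorings_def)
    qed
    show "proper_colorings G C \<subseteq> ?F ` ?S"
    proof
      fix f assume f: "f \<in> proper_colorings G C"
      define P where "P = color_classes (fst G) f"
      define g where "g = (\<lambda>B\<in>P. f (SOME v. v \<in> B))"
      have part: "partition_on (fst G) P"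
        by (simp add: P_def partition_on_color_classes)
      have g_block: "g B = f v" if "B \<in> P" "v \<in> B" for B v
      proof -
        have "(SOME v. v \<in> B) \<in> B"
          using that(2) by (rule someI)
        then show ?thesis
          using that by (auto simp: g_def P_def color_classes_def)
      qed
      have "f = ?F (P, g)"
      proof
        fix v show "f v = ?F (P, g) v"
          using f g_block[OF block_of_mem[OF part]]
          by (auto simp: color_blocks_def proper_colorings_def PiE_def extensional_def)
      qed
      moreover have "P \<in> stable_partitions G"
        using f part by (fastforce simp: P_def stable_partitions_def color_classes_def proper_colorings_def)
      moreover have "g \<in> P \<rightarrow>\<^sub>E C"
      proof (rule PiE_I)
        fix B assume "B \<in> P"
        moreover from this obtain v where "v \<in> B" "v \<in> fst G"
          by (auto simp: P_def color_classes_def)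
        ultimately show "g B \<in> C"
          using g_block f by (auto simp: proper_colorings_def)
      qed (simp add: g_def)
      moreover have "inj_on g P"
      proof (rule inj_onI)
        fix A B assume AB: "A \<in> P" "B \<in> P" "g A = g B"
        then obtain a b where "a \<in> A" "b \<in> B"
          "A = {v \<in> fst G. f v = f a}" "B = {v \<in> fst G. f v = f b}"
          by (auto simp: P_def color_classes_def)
        then show "A = B"
          using AB g_block by metis
      qed
      ultimately show "f \<in> ?F ` ?S"
        by blast
    qed
  qed
qed

lemma finite_stable_partitions: "finite (fst G) \<Longrightarrow> finite (stable_partitions G)"
  by (rule finite_subset[OF _ finitely_many_partition_on[of "fst G"]])
    (auto simp: stable_partitions_def)

lemma graph_stirling_eq: "graph_stirling G k = card {P \<in> stable_partitions G. card P = k}"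
  by (auto simp: graph_stirling_def stable_partitions_def intro!: arg_cong[where f = card])

lemma graph_stirling_support:
  "finite (fst G) \<Longrightarrow> {k. graph_stirling G k \<noteq> 0} = card ` stable_partitions G"
  by (auto simp: graph_stirling_eq finite_stable_partitions)

lemma card_proper_colorings:
  assumes "wf_graph G" "finite C"
  shows "card (proper_colorings G C) =
    (\<Sum>k | graph_stirling G k \<noteq> 0. graph_stirling G k * falling_fact (card C) k)"
proof -
  have fin: "finite (fst G)"
    using assms by (simp add: wf_graph_def)
  have finP: "finite P" if "P \<in> stable_partitions G" for P
    using that fin finite_elements by (auto simp: stable_partitions_def)
  have inj: "card {g \<in> P \<rightarrow>\<^sub>E C. inj_on g P} = falling_fact (card C) (card P)"
    if "P \<in> stable_partitions G" for P
    using card_inj_on_subset_funcset[OF finP[OF that] assms(2) subset_refl]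
    by (simp add: falling_fact_def)
  have "card (proper_colorings G C) =
      card (SIGMA P:stable_partitions G. {g \<in> P \<rightarrow>\<^sub>E C. inj_on g P})"
    by (rule bij_betw_same_card[OF bij_betw_color_blocks[OF assms(1)], symmetric])
  also have "\<dots> = (\<Sum>P\<in>stable_partitions G. falling_fact (card C) (card P))"
    using finP assms(2) by (subst card_SigmaI) (auto simp: inj finite_stable_partitions fin finite_PiE)
  also have "\<dots> = (\<Sum>k | graph_stirling G k \<noteq> 0.
      \<Sum>P | P \<in> stable_partitions G \<and> card P = k. falling_fact (card C) (card P))"
    unfolding graph_stirling_support[OF fin]
    using finite_stable_partitions[OF fin] by (subst sum.group) auto
  also have "\<dots> = (\<Sum>k | graph_stirling G k \<noteq> 0. graph_stirling G k * falling_fact (card C) k)"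
    by (intro sum.cong) (auto simp: graph_stirling_eq)
  finally show ?thesis .
qed

lemma card_proper_colorings_cong:
  assumes "wf_graph G" "finite C" "finite C'" "card C = card C'"
  shows "card (proper_colorings G C) = card (proper_colorings G C')"
  using assms by (simp add: card_proper_colorings)

lemma finite_proper_colorings: "wf_graph G \<Longrightarrow> finite C \<Longrightarrow> finite (proper_colorings G C)"
  by (rule finite_subset[of _ "fst G \<rightarrow>\<^sub>E C"]) (auto simp: proper_colorings_def wf_graph_def finite_PiE)

text \<open>
  Once the dominating vertex has its colour \<open>c\<close>, the rest is a proper colouring of \<open>G\<close> that avoids \<open>c\<close>.
  For \<open>n = 0\<close> the truncated \<open>n - 1\<close> is harmless because of the factor \<open>n\<close>.
\<close>

lemma card_proper_colorings_add_dominating: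
  assumes "wf_graph G" "v \<notin> fst G"
  shows "card (proper_colorings (add_dominating v G) {..<n}) =
    n * card (proper_colorings G {..<n - 1})"
proof -
  have edge_v: "v \<notin> e" if "e \<in> snd G" for e
    using that assms by (auto simp: wf_graph_def)
  have bij: "bij_betw (\<lambda>(c, f). f(v := c))
    (SIGMA c:{..<n}. proper_colorings G ({..<n} - {c})) (proper_colorings (add_dominating v G) {..<n})"
  proof (rule bij_betw_byWitness[where f' = "\<lambda>f. (f v, f(v := undefined))"])
    show "\<forall>a\<in>SIGMA c:{..<n}. proper_colorings G ({..<n} - {c}).
      (\<lambda>f. (f v, f(v := undefined))) (case a of (c, f) \<Rightarrow> f(v := c)) = a"
      using assms(2) by (auto simp: proper_colorings_def PiE_def extensional_def fun_eq_iff)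
    show "\<forall>f\<in>proper_colorings (add_dominating v G) {..<n}.
      (case (f v, f(v := undefined)) of (c, f) \<Rightarrow> f(v := c)) = f"
      by auto
    show "(\<lambda>(c, f). f(v := c)) ` (SIGMA c:{..<n}. proper_colorings G ({..<n} - {c}))
      \<subseteq> proper_colorings (add_dominating v G) {..<n}"
    proof (rule image_subsetI)
      fix p assume "p \<in> (SIGMA c:{..<n}. proper_colorings G ({..<n} - {c}))"
      then obtain c f where p: "p = (c, f)" and c: "c \<in> {..<n}"
        and f: "f \<in> proper_colorings G ({..<n} - {c})"
        by auto
      have old: "\<exists>u\<in>e. (f(v := c)) u \<noteq> d" if "e \<in> snd G" for e d
      proof -
        have "\<exists>u\<in>e. f u \<noteq> d"
          using \<open>e \<in> snd G\<close> f by (simp add: proper_colorings_def)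
        then show ?thesis
          using edge_v[OF that] by (metis fun_upd_other)
      qed
      have new: "\<exists>w\<in>{v, u}. (f(v := c)) w \<noteq> d" if "u \<in> fst G" for u d
        using that f assms(2) by (auto simp: proper_colorings_def)
      have "f(v := c) \<in> proper_colorings (add_dominating v G) {..<n}"
      proof (rule proper_coloringsI)
        show "f(v := c) \<in> fst (add_dominating v G) \<rightarrow>\<^sub>E {..<n}"
          using f c by (auto simp: proper_colorings_def add_dominating_def PiE_def extensional_def)
        fix e d assume "e \<in> snd (add_dominating v G)"
        then consider "e \<in> snd G" | u where "u \<in> fst G" "e = {v, u}"
          by (auto simp: add_dominating_def)
        then show "\<exists>w\<in>e. (f(v := c)) w \<noteq> d"
          using old new by cases blast+
      qed
      then show "(case p of (c, f) \<Rightarrow> f(v := c)) \<in> proper_colorings (add_dominating v G) {..<n}"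
        by (simp add: p)
    qed
    show "(\<lambda>f. (f v, f(v := undefined))) ` proper_colorings (add_dominating v G) {..<n}
      \<subseteq> (SIGMA c:{..<n}. proper_colorings G ({..<n} - {c}))"
    proof (rule image_subsetI)
      fix f assume f: "f \<in> proper_colorings (add_dominating v G) {..<n}"
      have ncol: "\<exists>w\<in>e. f w \<noteq> d" if "e \<in> snd (add_dominating v G)" for e d
        using f that by (simp add: proper_colorings_def)
      have "f u \<noteq> f v" if "u \<in> fst G" for u
        using ncol[of "{v, u}" "f v"] that by (auto simp: add_dominating_def)
      moreover have "\<exists>u\<in>e. (f(v := undefined)) u \<noteq> d" if e: "e \<in> snd G" for e d
      proof -
        obtain u where "u \<in> e" "f u \<noteq> d"
          using ncol[of e d] e by (auto simp: add_dominating_def)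
        then show ?thesis
          using edge_v[OF e] by (intro bexI[of _ u]) auto
      qed
      ultimately show "(f v, f(v := undefined)) \<in> (SIGMA c:{..<n}. proper_colorings G ({..<n} - {c}))"
        using f assms(2) by (auto simp: proper_colorings_def add_dominating_def PiE_def extensional_def)
    qed
  qed
  have "card (proper_colorings (add_dominating v G) {..<n}) =
      (\<Sum>c<n. card (proper_colorings G ({..<n} - {c})))"
    unfolding bij_betw_same_card[OF bij, symmetric]
    using finite_proper_colorings[OF assms(1)] by (intro card_SigmaI) auto
  also have "\<dots> = (\<Sum>c<n. card (proper_colorings G {..<n - 1}))"
    by (intro sum.cong refl card_proper_colorings_cong[OF assms(1)]) auto
  finally show ?thesis
    by simp
qed

text \<open>No edge runs between the two graphs, so the restrictions to them can be chosen independently.\<close>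

lemma card_proper_colorings_union:
  assumes "wf_graph G" "wf_graph H" "fst G \<inter> fst H = {}"
  shows "card (proper_colorings (fst G \<union> fst H, snd G \<union> snd H) C) =
    card (proper_colorings G C) * card (proper_colorings H C)"
proof -
  let ?U = "(fst G \<union> fst H, snd G \<union> snd H)"
  have G: "restrict f (fst G) v = f v" if "e \<in> snd G" "v \<in> e" for f :: "'a \<Rightarrow> 'b" and e v
    using that assms(1) by (auto simp: wf_graph_def)
  have H: "restrict f (fst H) v = f v" if "e \<in> snd H" "v \<in> e" for f :: "'a \<Rightarrow> 'b" and e v
    using that assms(2) by (auto simp: wf_graph_def)
  let ?join = "\<lambda>(f, g) v. if v \<in> fst G then f v else g v"
  have joinG: "?join (f, g) v = f v" if "e \<in> snd G" "v \<in> e" for f g :: "'a \<Rightarrow> 'b" and e v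
    using that assms(1) by (auto simp: wf_graph_def)
  have joinH: "?join (f, g) v = g v" if "e \<in> snd H" "v \<in> e" for f g :: "'a \<Rightarrow> 'b" and e v
    using that assms(2,3) by (auto simp: wf_graph_def)
  have "bij_betw (\<lambda>f. (restrict f (fst G), restrict f (fst H)))
    (proper_colorings ?U C) (proper_colorings G C \<times> proper_colorings H C)"
  proof (rule bij_betw_byWitness[where f' = ?join])
    show "\<forall>f\<in>proper_colorings ?U C. ?join (restrict f (fst G), restrict f (fst H)) = f"
      by (auto simp: proper_colorings_def PiE_def extensional_def fun_eq_iff)
    show "\<forall>p\<in>proper_colorings G C \<times> proper_colorings H C.
      (restrict (?join p) (fst G), restrict (?join p) (fst H)) = p"
      using assms(3) by (auto simp: proper_colorings_def PiE_def extensional_def fun_eq_iff)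
    show "(\<lambda>f. (restrict f (fst G), restrict f (fst H))) ` proper_colorings ?U C
      \<subseteq> proper_colorings G C \<times> proper_colorings H C"
    proof (rule image_subsetI)
      fix f assume f: "f \<in> proper_colorings ?U C"
      have "\<exists>v\<in>e. restrict f (fst G) v \<noteq> c" if "e \<in> snd G" for e c
        using f that G[OF that] by (fastforce simp: proper_colorings_def)
      moreover have "\<exists>v\<in>e. restrict f (fst H) v \<noteq> c" if "e \<in> snd H" for e c
        using f that H[OF that] by (fastforce simp: proper_colorings_def)
      ultimately show "(restrict f (fst G), restrict f (fst H)) \<in>
          proper_colorings G C \<times> proper_colorings H C"
        using f by (auto simp: proper_colorings_def)
    qed
    show "?join ` (proper_colorings G C \<times> proper_colorings H C) \<subseteq> proper_colorings ?U C"
    proof (rule image_subsetI)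
      fix p assume "p \<in> proper_colorings G C \<times> proper_colorings H C"
      then obtain f g where p: "p = (f, g)"
        and f: "f \<in> proper_colorings G C" and g: "g \<in> proper_colorings H C"
        by auto
      have edgeG: "\<exists>v\<in>e. ?join (f, g) v \<noteq> c" if "e \<in> snd G" for e c
        using f that joinG[OF that, of _ f g] by (fastforce simp: proper_colorings_def)
      have edgeH: "\<exists>v\<in>e. ?join (f, g) v \<noteq> c" if "e \<in> snd H" for e c
        using g that joinH[OF that, of _ f g] by (fastforce simp: proper_colorings_def)
      show "?join p \<in> proper_colorings ?U C"
        unfolding p
      proof (rule proper_coloringsI)
        show "?join (f, g) \<in> fst ?U \<rightarrow>\<^sub>E C"
          using f g by (auto simp: proper_colorings_def PiE_def extensional_def)
        fix e c assume "e \<in> snd ?U"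
        then have "e \<in> snd G \<or> e \<in> snd H"
          by simp
        then show "\<exists>v\<in>e. ?join (f, g) v \<noteq> c"
          using edgeG edgeH by blast
      qed
    qed
  qed
  from bij_betw_same_card[OF this] show ?thesis
    by (simp add: card_cartesian_product)
qed

section \<open>Dyck words acting on powers\<close>

lemma word_op_append: "word_op (u @ v) f = word_op u (word_op v f)"
  by (induction u) auto

lemma deriv_monomial: "deriv (\<lambda>t::real. c * t ^ n) = (\<lambda>t. c * real n * t ^ (n - 1))"
  by (auto intro!: DERIV_imp_deriv derivative_eq_intros)

lemma wf_add_dominating: "wf_graph G \<Longrightarrow> wf_graph (add_dominating v G)"
  by (auto simp: wf_graph_def add_dominating_def)

lemma graph_union_Cons:
  "graph_union (G # Gs) = (fst G \<union> fst (graph_union Gs), snd G \<union> snd (graph_union Gs))"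
  by (simp add: graph_union_def)

text \<open>
  The factor \<open>c\<close> allows the property to be chained, since each word in a product receives a multiple
  of a power and not the power itself.
\<close>

definition acts_by_colorings :: "letter list \<Rightarrow> 'v graph \<Rightarrow> bool" where
  "acts_by_colorings w G \<longleftrightarrow> wf_graph G \<and>
     (\<forall>c n. word_op w (\<lambda>t. c * t ^ n) =
            (\<lambda>t. c * real (card (proper_colorings G {..<n})) * t ^ n))"

lemma acts_by_colorings_union:
  fixes Gs :: "'v graph list"
  assumes "list_all2 acts_by_colorings ws Gs" "pairwise_disjoint Gs"
  shows "acts_by_colorings (concat ws) (graph_union Gs)"
  using assms
proof (induction rule: list_all2_induct)
  case Nil
  have "proper_colorings (({}, {}) :: 'v graph) C = {\<lambda>_. undefined}" for C :: "nat set"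
    by (auto simp: proper_colorings_def)
  then show ?case
    by (simp add: acts_by_colorings_def graph_union_def wf_graph_def)
next
  case (Cons w ws G Gs)
  let ?H = "graph_union Gs"
  have IH: "acts_by_colorings (concat ws) ?H" and w: "acts_by_colorings w G"
    using Cons by (auto simp: pairwise_disjoint_def)
  have disj: "fst G \<inter> fst ?H = {}"
    using Cons.prems by (auto simp: pairwise_disjoint_def graph_union_def)
  have wf: "wf_graph G" "wf_graph ?H"
    using w IH by (auto simp: acts_by_colorings_def)
  then have "wf_graph (graph_union (G # Gs))"
    by (auto simp: wf_graph_def graph_union_Cons)
  moreover have "word_op (concat (w # ws)) (\<lambda>t. c * t ^ n) =
      (\<lambda>t. c * real (card (proper_colorings (graph_union (G # Gs)) {..<n})) * t ^ n)" for c n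
  proof -
    have "word_op w (\<lambda>t. c * t ^ n) = (\<lambda>t. c * real (card (proper_colorings G {..<n})) * t ^ n)"
      and "word_op (concat ws) (\<lambda>t. c * t ^ n) =
        (\<lambda>t. c * real (card (proper_colorings ?H {..<n})) * t ^ n)" for c
      using w IH by (simp_all add: acts_by_colorings_def)
    note act = this
    show ?thesis
      unfolding concat.simps word_op_append act graph_union_Cons
        card_proper_colorings_union[OF wf disj]
      by (simp add: mult_ac)
  qed
  ultimately show ?case
    by (simp add: acts_by_colorings_def)
qed

lemma dyck_graph_acts_by_colorings: "dyck_graph w G \<Longrightarrow> acts_by_colorings w G"
proof (induction rule: dyck_graph.induct)
  case (single v)
  have "card (proper_colorings ({v}, {}) {..<n}) = n" for n :: nat
    by (simp add: proper_colorings_def card_funcsetE)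
  moreover have "(\<lambda>t. t * (c * real n * t ^ (n - 1))) = (\<lambda>t. c * real n * t ^ n)" for c :: real and n
    by (cases n) (auto simp: fun_eq_iff)
  ultimately show ?case
    by (simp add: acts_by_colorings_def wf_graph_def deriv_monomial del: One_nat_def)
next
  case (dominate w' G v)
  have IH: "word_op w' (\<lambda>t. c * t ^ n) = (\<lambda>t. c * real (card (proper_colorings G {..<n})) * t ^ n)"
    for c n
    using dominate by (simp add: acts_by_colorings_def)
  have wf: "wf_graph G"
    using dominate by (simp add: acts_by_colorings_def)
  have "(\<lambda>t. t * (c * real n * a * t ^ (n - 1))) = (\<lambda>t. c * (real n * a) * t ^ n)"
    for a c :: real and n
    by (cases n) (auto simp: fun_eq_iff)
  then show ?case
    using wf card_proper_colorings_add_dominating[OF wf \<open>v \<notin> fst G\<close>]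
    by (simp add: acts_by_colorings_def wf_add_dominating word_op_append deriv_monomial IH
        del: One_nat_def)
next
  case (disjoint_union ws Gs)
  then have "list_all2 acts_by_colorings ws Gs"
    by (auto elim: list_all2_mono)
  then show ?case
    using disjoint_union acts_by_colorings_union by blast
qed

section \<open>Normal expansions\<close>

lemma higher_deriv_power: "(deriv ^^ k) (\<lambda>t::real. t ^ n) = (\<lambda>t. real (falling_fact n k) * t ^ (n - k))"
proof (induction k)
  case 0
  then show ?case by (simp add: falling_fact_def)
next
  case (Suc k)
  then show ?case by (simp add: deriv_monomial falling_fact_Suc)
qed

lemma smooth_pos_power: "smooth_pos (\<lambda>t. t ^ n)"
  by (auto simp: smooth_pos_def higher_deriv_power
      intro!: differentiable_at_imp_differentiable_on derivative_intros)

text \<open>At \<open>t = 1\<close> all powers of \<open>t\<close> in the expansion disappear, the leading one included.\<close>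

lemma normal_expansion_at_powers:
  assumes "is_normal_expansion w S"
  shows "word_op w (\<lambda>t. t ^ n) 1 = of_int (\<Sum>k | S k \<noteq> 0. S k * int (falling_fact n k))"
  using assms smooth_pos_power[of n]
  by (simp add: is_normal_expansion_def higher_deriv_power)

lemma smooth_pos_DERIV:
  assumes "smooth_pos f" "t > 0"
  shows "((deriv ^^ k) f has_field_derivative (deriv ^^ Suc k) f t) (at t)"
proof -
  have "(deriv ^^ k) f differentiable at t"
    using assms by (auto simp: smooth_pos_def differentiable_on_eq_differentiable_at)
  then show ?thesis
    by (simp add: DERIV_deriv_iff_real_differentiable)
qed

text \<open>
  Absorbing the leading power of \<open>t\<close> into the sum and bounding the support by \<open>N\<close> makes both letters
  easy to apply: \<open>x\<close> only raises the exponents and keeps the coefficients, while by the product rule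
  \<open>D\<close> turns \<open>S k\<close> into \<open>(d + k) S k + S (k - 1)\<close>, where \<open>d\<close> is the excess of \<open>x\<close>'s over \<open>D\<close>'s.
\<close>

lemma word_expansion:
  "\<exists>(S :: nat \<Rightarrow> int) N. (\<forall>k\<ge>N. S k = 0) \<and>
     (\<forall>f t. smooth_pos f \<longrightarrow> t > 0 \<longrightarrow> word_op w f t =
       (\<Sum>k<N. of_int (S k) * t powi (int (count_list w X) - int (count_list w D) + int k) *
               (deriv ^^ k) f t))"
proof (induction w)
  case Nil
  show ?case
    by (intro exI[of _ "\<lambda>k. if k = 0 then 1 else 0"] exI[of _ "1::nat"]) auto
next
  case (Cons a w)
  define d where "d = int (count_list w X) - int (count_list w D)"
  obtain S :: "nat \<Rightarrow> int" and N where S0: "\<And>k. k \<ge> N \<Longrightarrow> S k = 0"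
    and S: "\<And>f t. smooth_pos f \<Longrightarrow> t > 0 \<Longrightarrow> word_op w f t =
       (\<Sum>k<N. of_int (S k) * t powi (d + int k) * (deriv ^^ k) f t)"
    using Cons.IH unfolding d_def by blast
  show ?case
  proof (cases a)
    case X
    have x_times: "t * (of_int (S k) * t powi (d + int k) * y) = of_int (S k) * t powi (d + 1 + int k) * y"
      if "t > 0" for t y :: real and k
      using that by (simp add: power_int_add)
    then have "word_op (a # w) f t = (\<Sum>k<N. of_int (S k) * t powi (d + 1 + int k) * (deriv ^^ k) f t)"
      if "smooth_pos f" "t > 0" for f t
      using X by (simp only: word_op.simps letter_op.simps S[OF that] sum_distrib_left x_times[OF that(2)])
    then show ?thesis
      using S0 X by (intro exI[of _ S] exI[of _ N]) (simp add: d_def algebra_simps)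
  next
    case D
    define T where "T k = (d + int k) * S k + (case k of 0 \<Rightarrow> 0 | Suc j \<Rightarrow> S j)" for k
    have "word_op (a # w) f t = (\<Sum>k<Suc N. of_int (T k) * t powi (d - 1 + int k) * (deriv ^^ k) f t)"
      if f: "smooth_pos f" and t: "t > 0" for f t
    proof -
      let ?g = "\<lambda>t. \<Sum>k<N. of_int (S k) * t powi (d + int k) * (deriv ^^ k) f t"
      let ?A = "\<lambda>k. of_int ((d + int k) * S k) * t powi (d - 1 + int k) * (deriv ^^ k) f t"
      let ?B = "\<lambda>k. of_int (S k) * t powi (d + int k) * (deriv ^^ Suc k) f t"
      have "(?g has_field_derivative (\<Sum>k<N. ?A k + ?B k)) (at t)"
      proof (rule DERIV_sum)
        fix k
        show "((\<lambda>t. of_int (S k) * t powi (d + int k) * (deriv ^^ k) f t)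
          has_field_derivative ?A k + ?B k) (at t)"
          using t
          by (auto intro!: derivative_eq_intros smooth_pos_DERIV[OF f t, THEN DERIV_cong]
            simp del: funpow.simps simp: algebra_simps)
      qed
      \<comment> \<open>The expansion of \<open>w\<close> is an identity on \<open>(0,\<infinity>)\<close> only; as that set is open, it may still be
        differentiated.\<close>
      then have "(word_op w f has_field_derivative (\<Sum>k<N. ?A k + ?B k)) (at t)"
        by (rule has_field_derivative_transform_within_open[of _ _ _ "{0<..}"])
          (use t S[OF f] in auto)
      then have "word_op (a # w) f t = (\<Sum>k<N. ?A k) + (\<Sum>k<N. ?B k)"
        using D by (simp add: DERIV_imp_deriv sum.distrib)
      \<comment> \<open>Bring both sums to the range \<open>k < N + 1\<close>: the first has a vanishing last term, the second
        is shifted by one.\<close>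
      also have "(\<Sum>k<N. ?A k) = (\<Sum>k<Suc N. ?A k)"
        by (simp add: S0)
      also have "(\<Sum>k<N. ?B k) = (\<Sum>k<Suc N. of_int (case k of 0 \<Rightarrow> 0 | Suc j \<Rightarrow> S j) *
          t powi (d - 1 + int k) * (deriv ^^ k) f t)"
        by (subst sum.lessThan_Suc_shift) (simp add: algebra_simps)
      also have "(\<Sum>k<Suc N. ?A k) + \<dots> =
          (\<Sum>k<Suc N. of_int (T k) * t powi (d - 1 + int k) * (deriv ^^ k) f t)"
        unfolding sum.distrib[symmetric] by (intro sum.cong) (auto simp: T_def algebra_simps)
      finally show ?thesis .
    qed
    moreover have "T k = 0" if "k \<ge> Suc N" for k
      using that S0 by (auto simp: T_def split: nat.split)
    ultimately show ?thesis
      using D by (intro exI[of _ T] exI[of _ "Suc N"]) (simp add: d_def algebra_simps)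
  qed
qed

lemma normal_expansion_exists: "\<exists>S. is_normal_expansion w S"
proof -
  define d where "d = int (count_list w X) - int (count_list w D)"
  obtain S :: "nat \<Rightarrow> int" and N where S0: "\<And>k. k \<ge> N \<Longrightarrow> S k = 0"
    and S: "\<And>f t. smooth_pos f \<Longrightarrow> t > 0 \<Longrightarrow> word_op w f t =
       (\<Sum>k<N. of_int (S k) * t powi (d + int k) * (deriv ^^ k) f t)"
    using word_expansion[of w] unfolding d_def by blast
  have sub: "{k. S k \<noteq> 0} \<subseteq> {..<N}"
    using S0 by (auto simp: not_le[symmetric])
  then have fin: "finite {k. S k \<noteq> 0}"
    using finite_subset by blast
  have "word_op w f t = t powi d * (\<Sum>k | S k \<noteq> 0. of_int (S k) * t ^ k * (deriv ^^ k) f t)"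
    if "smooth_pos f" "t > 0" for f t
  proof -
    have "word_op w f t = (\<Sum>k<N. t powi d * (of_int (S k) * t ^ k * (deriv ^^ k) f t))"
      using that by (simp add: S power_int_add mult_ac)
    also have "\<dots> = t powi d * (\<Sum>k<N. of_int (S k) * t ^ k * (deriv ^^ k) f t)"
      by (simp add: sum_distrib_left)
    also have "(\<Sum>k<N. of_int (S k) * t ^ k * (deriv ^^ k) f t) =
        (\<Sum>k | S k \<noteq> 0. of_int (S k) * t ^ k * (deriv ^^ k) f t)"
      using sub by (intro sum.mono_neutral_right) auto
    finally show ?thesis .
  qed
  then show ?thesis
    using fin unfolding is_normal_expansion_def d_def by blast
qed

lemma normal_expansion_unique:
  assumes "is_normal_expansion w S" "is_normal_expansion w T"
  shows "S = T"
proof (rule falling_fact_coeffs_unique)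
  show "(\<Sum>k | S k \<noteq> 0. S k * int (falling_fact n k)) =
      (\<Sum>k | T k \<noteq> 0. T k * int (falling_fact n k))" for n
    using normal_expansion_at_powers[OF assms(1), of n] normal_expansion_at_powers[OF assms(2), of n]
    by (metis of_int_eq_iff)
qed (use assms in \<open>auto simp: is_normal_expansion_def\<close>)

lemma word_stirling_expansion: "is_normal_expansion w (word_stirling w)"
  unfolding word_stirling_def
  using normal_expansion_exists normal_expansion_unique by (metis theI)

theorem theorem2p3:
  fixes w :: "letter list" and G :: "'v graph" and k :: nat
  assumes "dyck_word w" and "dyck_graph w G"
  shows "word_stirling w k = int (graph_stirling G k)"
proof -
  have acts: "acts_by_colorings w G"
    using assms(2) by (rule dyck_graph_acts_by_colorings)
  then have wf: "wf_graph G"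
    by (simp add: acts_by_colorings_def)
  have act: "word_op w (\<lambda>t. c * t ^ n) =
      (\<lambda>t. c * real (card (proper_colorings G {..<n})) * t ^ n)" for c n
    using acts by (simp add: acts_by_colorings_def)
  have "word_stirling w = (\<lambda>k. int (graph_stirling G k))"
  proof (rule falling_fact_coeffs_unique)
    fix n
    have "of_int (\<Sum>k | word_stirling w k \<noteq> 0. word_stirling w k * int (falling_fact n k)) =
        word_op w (\<lambda>t. t ^ n) 1"
      by (rule normal_expansion_at_powers[OF word_stirling_expansion, symmetric])
    also have "\<dots> = of_int (int (card (proper_colorings G {..<n})))"
      using act[of 1 n] by simp
    finally have "(\<Sum>k | word_stirling w k \<noteq> 0. word_stirling w k * int (falling_fact n k)) =
        int (card (proper_colorings G {..<n}))"
      by (simp only: of_int_eq_iff)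
    then show "(\<Sum>k | word_stirling w k \<noteq> 0. word_stirling w k * int (falling_fact n k)) =
        (\<Sum>k | int (graph_stirling G k) \<noteq> 0. int (graph_stirling G k) * int (falling_fact n k))"
      using wf by (simp add: card_proper_colorings)
  next
    show "finite {k. word_stirling w k \<noteq> 0}"
      using word_stirling_expansion by (simp add: is_normal_expansion_def)
  next
    have "finite (fst G)"
      using wf by (simp add: wf_graph_def)
    then show "finite {k. int (graph_stirling G k) \<noteq> 0}"
      using graph_stirling_support[of G] finite_stable_partitions[of G] by simp
  qed
  then show ?thesis
    by simp
qed

end
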